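(* Let $p\geq 1$ and $q\geq 0$ be integers. There exists an isometric embedding $\iota_{p,q}\colon\mathcal H^{p,q}\to\mathbb H^{p,q}$ of the half-space model into pseudo-hyperbolic space. If $q=0$, then $\iota_{p,q}$ is surjective. Otherwise (if $q\geq 1$), its image is the complement of a totally geodesic degenerate hyperplane in $\mathbb H^{p,q}$.
   Context: $\mathbb R^{a,b}$ denotes $\mathbb R^{a+b}$ with the bilinear form $\langle X,Y\rangle=X_1Y_1+\dots+X_aY_a-X_{a+1}Y_{a+1}-\dots-X_{a+b}Y_{a+b}$. Set $\widetilde{\mathbb H}^{p,q}=\{X\in\mathbb R^{p,q+1} : \langle X,X\rangle=-1\}$ with the pseudo-Riemannian metric of signature $(p,q)$ induced by $\langle\cdot,\cdot\rangle$, and $\mathbb H^{p,q}=\widetilde{\mathbb H}^{p,q}/\{\pm\mathrm{Id}\}$ with the quotient metric. The half-space model is $\mathcal H^{p,q}=\{(x,y,z)\in\mathbb R^{p-1}\oplus\mathbb R^q\oplus\mathbb R : z>0\}$ with the pseudo-Riemannian metric $g_{p,q}=\frac{dx_1^2+\dots+dx_{p-1}^2-dy_1^2-\dots-dy_q^2+dz^2}{z^2}$. A totally geodesic hyperplane of $\mathbb H^{p,q}$ is the projection to $\mathbb H^{p,q}$ of $\widetilde{\mathbb H}^{p,q}\cap P$, where $P$ is a linear hyperplane of $\mathbb R^{p,q+1}$; it is degenerate if the restriction of $\langle\cdot,\cdot\rangle$ to $P$ is degenerate, i.e. $P=V^\perp$ for a nonzero vector $V$ with $\langle V,V\rangle=0$.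 *)

theory Defs
  imports "HOL-Analysis.Analysis"
begin

text \<open>
  \<open>\<real>\<^sup>n\<close> is \<open>real ^ 'n\<close> with \<open>CARD('n) = n\<close>.  A finite index type carries no canonical order, so a
  numbering \<open>1, \<dots>, n\<close> of the coordinates is chosen once and for all.
\<close>

definition index :: "nat \<Rightarrow> 'n::finite" where
  "index = (SOME e. bij_betw e {1..CARD('n)} UNIV)"

lemma bij_betw_index: "bij_betw (index :: nat \<Rightarrow> 'n::finite) {1..CARD('n)} UNIV"
proof -
  have "\<exists>e. bij_betw e {1..CARD('n)} (UNIV :: 'n set)"
    by (rule finite_same_card_bij) auto
  then show ?thesis
    unfolding index_def by (rule someI_ex)
qed

definition coordinate :: "real ^ 'n::finite \<Rightarrow> nat \<Rightarrow> real" where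
  "coordinate X i = X $ index i"


section \<open>Smooth maps between Euclidean spaces\<close>

text \<open>\<open>Ck_on k f U\<close>: all iterated directional derivatives of \<open>f\<close> of order at most \<open>k\<close> exist and are
  continuous on the open set \<open>U\<close>.\<close>

primrec Ck_on :: "nat \<Rightarrow> ('a::euclidean_space \<Rightarrow> 'b::euclidean_space) \<Rightarrow> 'a set \<Rightarrow> bool" where
  "Ck_on 0 f U \<longleftrightarrow> continuous_on U f"
| "Ck_on (Suc k) f U \<longleftrightarrow>
     (\<forall>x\<in>U. f differentiable (at x)) \<and> (\<forall>v. Ck_on k (\<lambda>x. frechet_derivative f (at x) v) U)"

definition smooth_on :: "('a::euclidean_space \<Rightarrow> 'b::euclidean_space) \<Rightarrow> 'a set \<Rightarrow> bool" where
  "smooth_on f U \<longleftrightarrow> (\<forall>k. Ck_on k f U)"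

lemma smooth_on_imp_differentiable: "smooth_on f U \<Longrightarrow> x \<in> U \<Longrightarrow> f differentiable (at x)"
  unfolding smooth_on_def by (metis Ck_on.simps(2))

lemma smooth_on_imp_continuous_on: "smooth_on f U \<Longrightarrow> continuous_on U f"
  unfolding smooth_on_def by (metis Ck_on.simps(1))


section \<open>Pseudo-hyperbolic space\<close>

definition form :: "nat \<Rightarrow> nat \<Rightarrow> real ^ 'n::finite \<Rightarrow> real ^ 'n \<Rightarrow> real" where
  "form a b X Y =
     (\<Sum>i=1..a. coordinate X i * coordinate Y i) - (\<Sum>i=a+1..a+b. coordinate X i * coordinate Y i)"

definition quadric :: "nat \<Rightarrow> nat \<Rightarrow> (real ^ 'n::finite) set" where
  "quadric p q = {X. form p (q + 1) X X = -1}"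

text \<open>A point of the quotient by \<open>{\<plusminus>Id}\<close> is an orbit \<open>{X, -X}\<close>.\<close>

definition proj :: "real ^ 'n::finite \<Rightarrow> (real ^ 'n) set" where
  "proj X = {X, - X}"

definition hyp :: "nat \<Rightarrow> nat \<Rightarrow> (real ^ 'n::finite) set set" where
  "hyp p q = proj ` quadric p q"

definition hyp_topology :: "nat \<Rightarrow> nat \<Rightarrow> (real ^ 'n::finite) set topology" where
  "hyp_topology p q =
     topology (\<lambda>S. S \<subseteq> hyp p q \<and> openin (top_of_set (quadric p q)) {X \<in> quadric p q. proj X \<in> S})"

text \<open>
  A tangent vector of the quotient is a \<open>{\<plusminus>Id}\<close>-orbit in the tangent bundle of the quadric:
  \<open>tangent X V\<close> is the image, under the differential at \<open>X\<close> of the quotient map, of a vector \<open>V\<close>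
  tangent to the quadric at \<open>X\<close>.  The quotient metric makes the quotient map a local isometry.
\<close>

definition tangent :: "real ^ 'n::finite \<Rightarrow> real ^ 'n \<Rightarrow> ((real ^ 'n) \<times> (real ^ 'n)) set" where
  "tangent X V = {(X, V), (- X, - V)}"

definition hyp_metric :: "nat \<Rightarrow> nat \<Rightarrow>
    ((real ^ 'n::finite) \<times> (real ^ 'n)) set \<Rightarrow> ((real ^ 'n) \<times> (real ^ 'n)) set \<Rightarrow> real" where
  "hyp_metric p q \<xi> \<eta> =
     (THE r. \<exists>X V W. \<xi> = tangent X V \<and> \<eta> = tangent X W \<and> r = form p (q + 1) V W)"

text \<open>
  The quotient map is a two-fold covering, so a map into the quotient is smooth iff it lifts
  locally to a smooth map into the quadric; its differential is computed through any such lift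
  (\<open>hyp_differential_eq\<close> below).
\<close>

definition local_lift :: "nat \<Rightarrow> nat \<Rightarrow> ('a::euclidean_space \<Rightarrow> (real ^ 'n::finite) set) \<Rightarrow>
    ('a \<Rightarrow> real ^ 'n) \<Rightarrow> 'a set \<Rightarrow> bool" where
  "local_lift p q f F W \<longleftrightarrow>
     open W \<and> smooth_on F W \<and> F ` W \<subseteq> quadric p q \<and> (\<forall>w\<in>W. f w = proj (F w))"

definition smooth_into_hyp :: "nat \<Rightarrow> nat \<Rightarrow> 'a::euclidean_space set \<Rightarrow>
    ('a \<Rightarrow> (real ^ 'n::finite) set) \<Rightarrow> bool" where
  "smooth_into_hyp p q U f \<longleftrightarrow> (\<forall>u\<in>U. \<exists>F W. u \<in> W \<and> W \<subseteq> U \<and> local_lift p q f F W)"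

definition hyp_differential :: "nat \<Rightarrow> nat \<Rightarrow> ('a::euclidean_space \<Rightarrow> (real ^ 'n::finite) set) \<Rightarrow>
    'a \<Rightarrow> 'a \<Rightarrow> ((real ^ 'n) \<times> (real ^ 'n)) set" where
  "hyp_differential p q f u v =
     (THE \<xi>. \<exists>F W. u \<in> W \<and> local_lift p q f F W \<and> \<xi> = tangent (F u) (frechet_derivative F (at u) v))"

text \<open>The source is an open set \<open>U\<close> of a Euclidean space, with metric \<open>g u\<close> at the point \<open>u\<close>.\<close>

definition isometric_embedding :: "nat \<Rightarrow> nat \<Rightarrow> 'a::euclidean_space set \<Rightarrow>
    ('a \<Rightarrow> 'a \<Rightarrow> 'a \<Rightarrow> real) \<Rightarrow> ('a \<Rightarrow> (real ^ 'n::finite) set) \<Rightarrow> bool" where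
  "isometric_embedding p q U g f \<longleftrightarrow>
     smooth_into_hyp p q U f \<and>
     (\<forall>u\<in>U. inj (hyp_differential p q f u)) \<and>
     embedding_map (top_of_set U) (hyp_topology p q) f \<and>
     (\<forall>u\<in>U. \<forall>v w. hyp_metric p q (hyp_differential p q f u v) (hyp_differential p q f u w) = g u v w)"


section \<open>The half-space model\<close>

text \<open>In \<open>\<real>\<^sup>p\<^sup>-\<^sup>1 \<oplus> \<real>\<^sup>q \<oplus> \<real>\<close> the coordinates \<open>1, \<dots>, p - 1\<close> are \<open>x\<close>, the coordinates
  \<open>p, \<dots>, p + q - 1\<close> are \<open>y\<close>, and the coordinate \<open>p + q\<close> is \<open>z\<close>.\<close>

definition half_space :: "nat \<Rightarrow> nat \<Rightarrow> (real ^ 'm::finite) set" where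
  "half_space p q = {u. coordinate u (p + q) > 0}"

definition half_space_metric :: "nat \<Rightarrow> nat \<Rightarrow> real ^ 'm::finite \<Rightarrow> real ^ 'm \<Rightarrow> real ^ 'm \<Rightarrow> real" where
  "half_space_metric p q u v w =
     ((\<Sum>i=1..<p. coordinate v i * coordinate w i)
      - (\<Sum>i=p..<p+q. coordinate v i * coordinate w i)
      + coordinate v (p + q) * coordinate w (p + q)) / (coordinate u (p + q))\<^sup>2"


section \<open>Totally geodesic hyperplanes\<close>

definition linear_hyperplane :: "(real ^ 'n::finite) set \<Rightarrow> bool" where
  "linear_hyperplane P \<longleftrightarrow> subspace P \<and> dim P + 1 = CARD('n)"

definition degenerate_on :: "nat \<Rightarrow> nat \<Rightarrow> (real ^ 'n::finite) set \<Rightarrow> bool" where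
  "degenerate_on a b P \<longleftrightarrow> (\<exists>V\<in>P. V \<noteq> 0 \<and> (\<forall>W\<in>P. form a b V W = 0))"

definition geodesic_hyperplane :: "nat \<Rightarrow> nat \<Rightarrow> (real ^ 'n::finite) set \<Rightarrow> (real ^ 'n) set set" where
  "geodesic_hyperplane p q P = proj ` (quadric p q \<inter> P)"

definition totally_geodesic_degenerate_hyperplane ::
    "nat \<Rightarrow> nat \<Rightarrow> (real ^ 'n::finite) set set \<Rightarrow> bool" where
  "totally_geodesic_degenerate_hyperplane p q S \<longleftrightarrow>
     (\<exists>P. linear_hyperplane P \<and> degenerate_on p (q + 1) P \<and> S = geodesic_hyperplane p q P)"


section \<open>Well-definedness\<close>

lemma openin_hyp_topology:
  "openin (hyp_topology p q) S \<longleftrightarrow>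
     S \<subseteq> hyp p q \<and> openin (top_of_set (quadric p q)) {X \<in> quadric p q. proj X \<in> S}"
proof -
  let ?L = "\<lambda>S. S \<subseteq> hyp p q \<and> openin (top_of_set (quadric p q)) {X \<in> quadric p q. proj X \<in> S}"
  have "?L (S \<inter> T)" if "?L S" "?L T" for S T
  proof -
    have "{X \<in> quadric p q. proj X \<in> S \<inter> T} =
        {X \<in> quadric p q. proj X \<in> S} \<inter> {X \<in> quadric p q. proj X \<in> T}" by auto
    with that show ?thesis by (metis (no_types, lifting) openin_Int le_infI1)
  qed
  moreover have "?L (\<Union>K)" if "\<forall>S\<in>K. ?L S" for K
  proof -
    have "{X \<in> quadric p q. proj X \<in> \<Union>K} = (\<Union>S\<in>K. {X \<in> quadric p q. proj X \<in> S})" by auto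
    with that show ?thesis by (auto intro!: openin_Union)
  qed
  ultimately have "istopology ?L"
    unfolding istopology_def by blast
  then show ?thesis
    unfolding hyp_topology_def by (subst topology_inverse') auto
qed

lemma topspace_hyp_topology:
  "topspace (hyp_topology p q) = (hyp p q :: (real ^ 'n::finite) set set)" (is "?T = ?H")
proof
  show "?T \<subseteq> ?H"
    using openin_topspace[of "hyp_topology p q"] openin_hyp_topology by blast
  have "{X \<in> quadric p q. proj X \<in> ?H} = quadric p q"
    by (auto simp: hyp_def)
  then have "openin (hyp_topology p q) ?H"
    by (simp add: openin_hyp_topology)
  then show "?H \<subseteq> ?T"
    by (rule openin_subset)
qed

lemma zero_notin_quadric: "0 \<notin> quadric p q"
  by (simp add: quadric_def form_def coordinate_def)

lemma form_minus_minus: "form a b (- X) (- Y) = form a b X Y"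
  by (simp add: form_def coordinate_def)

lemma vec_eq_minus_self_iff: "X = - X \<longleftrightarrow> X = 0" for X :: "real ^ 'n::finite"
  by (auto simp: vec_eq_iff)

lemma hyp_metric_tangent:
  assumes "X \<noteq> 0"
  shows "hyp_metric p q (tangent X V) (tangent X W) = form p (q + 1) V W"
  unfolding hyp_metric_def
proof (rule the_equality)
  fix r assume "\<exists>X' V' W'. tangent X V = tangent X' V' \<and> tangent X W = tangent X' W' \<and>
      r = form p (q + 1) V' W'"
  then obtain X' V' W' where *: "tangent X V = tangent X' V'" "tangent X W = tangent X' W'"
    and r: "r = form p (q + 1) V' W'" by blast
  have "X \<noteq> - X"
    using assms iffD1[OF vec_eq_minus_self_iff] by metis
  moreover have "X' = X \<and> V' = V \<or> X' = - X \<and> V' = - V" "X' = X \<and> W' = W \<or> X' = - X \<and> W' = - W"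
    using * unfolding tangent_def doubleton_eq_iff by auto
  ultimately have "V' = V \<and> W' = W \<or> V' = - V \<and> W' = - W"
    by (elim disjE conjE) (auto dest: sym)
  with r show "r = form p (q + 1) V W"
    by (auto simp: form_minus_minus)
qed blast

lemma tangent_lift_unique:
  fixes f :: "'a::euclidean_space \<Rightarrow> (real ^ 'n::finite) set"
  assumes F: "local_lift p q f F W" "u \<in> W" and G: "local_lift p q f G W'" "u \<in> W'"
  shows "tangent (F u) (frechet_derivative F (at u) v) = tangent (G u) (frechet_derivative G (at u) v)"
proof -
  define \<Omega> where "\<Omega> = W \<inter> W'"
  have \<Omega>: "open \<Omega>" "u \<in> \<Omega>"
    using F G by (auto simp: \<Omega>_def local_lift_def)
  have cont: "continuous_on \<Omega> F" "continuous_on \<Omega> G"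
    using F G by (auto simp: \<Omega>_def local_lift_def
        intro: continuous_on_subset[OF smooth_on_imp_continuous_on])
  have dF: "(F has_derivative frechet_derivative F (at u)) (at u)"
   and dG: "(G has_derivative frechet_derivative G (at u)) (at u)"
    using F G by (auto simp: local_lift_def frechet_derivative_works[symmetric]
        intro: smooth_on_imp_differentiable)
  have Fu0: "F u \<noteq> 0"
    using F zero_notin_quadric[of p q] by (auto simp: local_lift_def)
  have pm: "G w = F w \<or> G w = - F w" if "w \<in> \<Omega>" for w
  proof -
    have "f w = proj (F w)" "f w = proj (G w)"
      using F G that unfolding \<Omega>_def local_lift_def by blast+
    then have "{F w, - F w} = {G w, - G w}"
      unfolding proj_def by (rule subst)
    then show ?thesis
      unfolding doubleton_eq_iff by auto
  qed
  have same: "frechet_derivative F (at u) = frechet_derivative H (at u)"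
    if H: "\<And>w. w \<in> \<Omega> \<Longrightarrow> H w = F w \<or> H w = - F w" "H u = F u" "continuous_on \<Omega> H"
      "(H has_derivative frechet_derivative H (at u)) (at u)" for H
  proof -
    define N where "N = \<Omega> \<inter> (\<lambda>w. F w + H w) -` (- {0})"
    have "open N"
      unfolding N_def using \<Omega> cont H
      by (intro continuous_open_preimage continuous_intros) auto
    moreover have "u \<in> N"
      using \<Omega> Fu0 by (simp add: N_def \<open>H u = F u\<close> flip: scaleR_2)
    moreover have "H w = F w" if "w \<in> N" for w
      using that H(1)[of w] by (auto simp: N_def)
    ultimately have "(F has_derivative frechet_derivative H (at u)) (at u)"
      using has_derivative_transform_within_open[OF H(4)] by blast
    then show ?thesis
      using dF has_derivative_unique by blast
  qed
  from pm[OF \<Omega>(2)] show ?thesis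
  proof
    assume "G u = F u"
    with same[of G] pm cont dG show ?thesis by simp
  next
    assume neg: "G u = - F u"
    let ?H = "\<lambda>w. - G w"
    have dH: "(?H has_derivative (\<lambda>h. - frechet_derivative G (at u) h)) (at u)"
      by (intro has_derivative_minus dG)
    then have eq: "frechet_derivative ?H (at u) = (\<lambda>h. - frechet_derivative G (at u) h)"
      using frechet_derivative_at by metis
    have "frechet_derivative F (at u) = frechet_derivative ?H (at u)"
    proof (rule same)
      show "- G w = F w \<or> - G w = - F w" if "w \<in> \<Omega>" for w
        using pm[OF that] by auto
      show "(?H has_derivative frechet_derivative ?H (at u)) (at u)"
        using dH eq by simp
    qed (use neg cont in \<open>auto intro: continuous_intros\<close>)
    with eq neg show ?thesis
      by (auto simp: tangent_def)
  qed
qed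

lemma hyp_differential_eq:
  assumes "local_lift p q f F W" "u \<in> W"
  shows "hyp_differential p q f u v = tangent (F u) (frechet_derivative F (at u) v)"
  unfolding hyp_differential_def
proof (rule the_equality)
  show "\<exists>F' W'. u \<in> W' \<and> local_lift p q f F' W' \<and>
      tangent (F u) (frechet_derivative F (at u) v) = tangent (F' u) (frechet_derivative F' (at u) v)"
    using assms by blast
qed (use assms tangent_lift_unique in blast)

end

theory Submission
  imports Defs
begin

text \<open>
  Write \<open>s = X\<^sub>p + X\<^sub>p\<^sub>+\<^sub>q\<^sub>+\<^sub>1\<close> and \<open>t = X\<^sub>p\<^sub>+\<^sub>q\<^sub>+\<^sub>1 - X\<^sub>p\<close>, and let \<open>w\<close> collect the other coordinates of \<open>X\<close>.  In
  these null coordinates \<open>\<langle>X, X\<rangle> = h(w, w) - s t\<close>, where \<open>h\<close> is the flat form of signature \<open>(p - 1, q)\<close>.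
  As soon as \<open>s \<noteq> 0\<close>, the equation \<open>\<langle>X, X\<rangle> = -1\<close> determines \<open>t\<close> from \<open>s\<close> and \<open>w\<close>, and exactly one point
  of each pair \<open>{X, -X}\<close> has \<open>s > 0\<close>.  Setting \<open>s = 1 / z\<close> and \<open>w = u / z\<close> thus parametrises the part
  \<open>s \<noteq> 0\<close> of the quotient by the half-space, through
  \[ F(u, z) = \frac{1}{z} (u + o) + \Bigl(z + \frac{h(u, u)}{z}\Bigr) e, \]
  where \<open>o\<close> and \<open>e\<close> are the null vectors with \<open>(s, t) = (1, 0)\<close> and \<open>(0, 1)\<close>.

  The induced metric is \<open>h(dw, dw) - ds dt\<close>, and substituting \<open>w = u / z\<close>, \<open>s = 1 / z\<close>,
  \<open>t = z + h(u, u) / z\<close> gives \<open>(h(du, du) + dz\<^sup>2) / z\<^sup>2\<close> (\<open>lift_isometry\<close>).  The inverse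
  \<open>X \<mapsto> (w / s, 1 / \<bar>s\<bar>)\<close> is invariant under \<open>X \<mapsto> -X\<close> and continuous on \<open>s \<noteq> 0\<close>; hence the map into the
  quotient is injective and open, that is, a topological embedding (\<open>embedding_map_proj_lift\<close>).

  The points that are missed are those of the hyperplane \<open>s = 0\<close>, which is the orthogonal complement of the
  null vector \<open>e\<close>.  If \<open>q = 0\<close>, then \<open>s = 0\<close> would force \<open>-1 = h(w, w) \<ge> 0\<close>, so nothing is missed.
\<close>

section \<open>Closure properties of smooth maps\<close>

lemma Ck_on_cong:
  assumes "open U" "\<And>x. x \<in> U \<Longrightarrow> f x = g x" "Ck_on k f U"
  shows "Ck_on k g U"
  using assms(2,3)
proof (induction k arbitrary: f g)
  case 0
  then show ?case
    by (simp cong: continuous_on_cong)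
next
  case (Suc k)
  have g: "(g has_derivative frechet_derivative f (at x)) (at x)" if "x \<in> U" for x
    using Suc.prems that \<open>open U\<close>
    by (auto intro: has_derivative_transform_within_open simp: frechet_derivative_works)
  then have eq: "frechet_derivative g (at x) = frechet_derivative f (at x)" if "x \<in> U" for x
    using frechet_derivative_at[OF g[OF that]] by simp
  have "Ck_on k (\<lambda>x. frechet_derivative g (at x) v) U" for v
    by (rule Suc.IH[of "\<lambda>x. frechet_derivative f (at x) v"]) (use Suc.prems eq in auto)
  with g show ?case
    by (auto simp: differentiable_def)
qed

text \<open>The derivative only has to be exhibited on \<open>U\<close>; it may be any other map off \<open>U\<close>.\<close>

lemma Ck_on_SucI:
  assumes "open U" "\<And>x. x \<in> U \<Longrightarrow> (f has_derivative f' x) (at x)"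
    and "\<And>v. Ck_on k (\<lambda>x. f' x v) U"
  shows "Ck_on (Suc k) f U"
proof -
  have "frechet_derivative f (at x) = f' x" if "x \<in> U" for x
    using frechet_derivative_at[OF assms(2)[OF that]] by simp
  then have "Ck_on k (\<lambda>x. frechet_derivative f (at x) v) U" for v
    using Ck_on_cong[OF \<open>open U\<close> _ assms(3)[of v]] by simp
  with assms(2) show ?thesis
    by (auto simp: differentiable_def)
qed

text \<open>
  The recursion defining \<^const>\<open>Ck_on\<close> controls the derivatives of \<open>f\<close> but not \<open>f\<close> itself at the lower
  order; this is what the product rule needs, where \<open>f\<close> appears next to a derivative of the other
  factor.
\<close>

lemma Ck_on_lower: "Ck_on (Suc k) f U \<Longrightarrow> Ck_on k f U"
proof (induction k arbitrary: f)
  case 0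
  then have "f differentiable_on U"
    by (simp add: differentiable_on_def differentiable_at_withinI)
  then show ?case
    by (simp add: differentiable_imp_continuous_on)
next
  case (Suc k)
  have "Ck_on (Suc k) (\<lambda>x. frechet_derivative f (at x) v) U" for v
    using Suc.prems unfolding Ck_on.simps(2)[of "Suc k"] by blast
  then have "Ck_on k (\<lambda>x. frechet_derivative f (at x) v) U" for v
    by (rule Suc.IH)
  with Suc.prems show ?case
    by simp
qed

lemma Ck_on_add:
  assumes "open U"
  shows "Ck_on k f U \<Longrightarrow> Ck_on k g U \<Longrightarrow> Ck_on k (\<lambda>x. f x + g x) U"
proof (induction k arbitrary: f g)
  case 0
  then show ?case
    by (auto intro: continuous_intros)
next
  case (Suc k)
  show ?case
  proof (rule Ck_on_SucI[OF assms])
    fix x assume "x \<in> U"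
    with Suc.prems show "((\<lambda>x. f x + g x) has_derivative
        (\<lambda>v. frechet_derivative f (at x) v + frechet_derivative g (at x) v)) (at x)"
      by (auto intro!: derivative_intros simp: frechet_derivative_works)
  next
    show "Ck_on k (\<lambda>x. frechet_derivative f (at x) v + frechet_derivative g (at x) v) U" for v
      by (rule Suc.IH) (use Suc.prems in simp_all)
  qed
qed

lemma Ck_on_bilinear:
  assumes "bounded_bilinear h" "open U"
  shows "Ck_on k f U \<Longrightarrow> Ck_on k g U \<Longrightarrow> Ck_on k (\<lambda>x. h (f x) (g x)) U"
proof (induction k arbitrary: f g)
  case 0
  then show ?case
    by (auto intro: bounded_bilinear.continuous_on[OF assms(1)])
next
  case (Suc k)
  show ?case
  proof (rule Ck_on_SucI[OF \<open>open U\<close>])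
    fix x assume "x \<in> U"
    with Suc.prems show "((\<lambda>x. h (f x) (g x)) has_derivative
        (\<lambda>v. h (f x) (frechet_derivative g (at x) v) + h (frechet_derivative f (at x) v) (g x)))
        (at x)"
      by (auto intro!: bounded_bilinear.FDERIV[OF assms(1)] simp: frechet_derivative_works)
  next
    show "Ck_on k (\<lambda>x. h (f x) (frechet_derivative g (at x) v)
        + h (frechet_derivative f (at x) v) (g x)) U" for v
    proof (rule Ck_on_add[OF \<open>open U\<close>])
      show "Ck_on k (\<lambda>x. h (f x) (frechet_derivative g (at x) v)) U"
        by (rule Suc.IH) (use Suc.prems Ck_on_lower[OF Suc.prems(1)] Ck_on_lower[OF Suc.prems(2)] in simp_all)
      show "Ck_on k (\<lambda>x. h (frechet_derivative f (at x) v) (g x)) U"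
        by (rule Suc.IH) (use Suc.prems Ck_on_lower[OF Suc.prems(1)] Ck_on_lower[OF Suc.prems(2)] in simp_all)
    qed
  qed
qed

lemma Ck_on_const: "Ck_on k (\<lambda>x. c) U"
  by (induction k arbitrary: c) auto

lemma Ck_on_linear:
  assumes "bounded_linear f"
  shows "Ck_on k f U"
proof (cases k)
  case 0
  then show ?thesis
    using assms linear_continuous_on by auto
next
  case (Suc l)
  have "(f has_derivative f) (at x)" for x
    by (rule bounded_linear_imp_has_derivative[OF assms])
  then have "frechet_derivative f (at x) = f" "f differentiable (at x)" for x
    by (auto simp: differentiable_def frechet_derivative_at[symmetric])
  with Suc show ?thesis
    by (simp add: Ck_on_const)
qed

lemma Ck_on_inverse:
  fixes f :: "'a::euclidean_space \<Rightarrow> real"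
  assumes "open U" "\<And>x. x \<in> U \<Longrightarrow> f x \<noteq> 0"
  shows "Ck_on k f U \<Longrightarrow> Ck_on k (\<lambda>x. inverse (f x)) U"
proof (induction k)
  case 0
  then show ?case
    using assms by (auto intro: continuous_intros)
next
  case (Suc k)
  show ?case
  proof (rule Ck_on_SucI[OF \<open>open U\<close>])
    fix x assume "x \<in> U"
    with Suc.prems assms show "((\<lambda>x. inverse (f x)) has_derivative
        (\<lambda>v. - 1 * (frechet_derivative f (at x) v * (inverse (f x) * inverse (f x))))) (at x)"
      by (auto intro!: derivative_eq_intros simp: frechet_derivative_works ac_simps)
  next
    show "Ck_on k (\<lambda>x. - 1 * (frechet_derivative f (at x) v * (inverse (f x) * inverse (f x)))) U" for v
      using Suc.prems Suc.IH[OF Ck_on_lower[OF Suc.prems]]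
      by (intro Ck_on_bilinear[OF bounded_bilinear_mult \<open>open U\<close>] Ck_on_const) simp_all
  qed
qed

section \<open>Null coordinates\<close>

definition of_coordinates :: "(nat \<Rightarrow> real) \<Rightarrow> real ^ 'n::finite" where
  "of_coordinates c = (\<chi> j. c (the_inv_into {1..CARD('n)} index j))"

lemma coordinate_of_coordinates:
  assumes "1 \<le> i" "i \<le> CARD('n::finite)"
  shows "coordinate (of_coordinates c :: real ^ 'n) i = c i"
  using assms bij_betw_index[where 'n='n]
  by (simp add: coordinate_def of_coordinates_def bij_betw_def the_inv_into_f_f)

lemma coordinate_eqI:
  fixes X Y :: "real ^ 'n::finite"
  assumes "\<And>i. 1 \<le> i \<Longrightarrow> i \<le> CARD('n) \<Longrightarrow> coordinate X i = coordinate Y i"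
  shows "X = Y"
proof -
  have "X $ j = Y $ j" for j
  proof -
    obtain i where "i \<in> {1..CARD('n)}" "j = index i"
      using bij_betw_index[where 'n='n] unfolding bij_betw_def by blast
    with assms[of i] show ?thesis
      by (simp add: coordinate_def)
  qed
  then show ?thesis
    by (simp add: vec_eq_iff)
qed

lemma coordinate_add [simp]: "coordinate (X + Y) i = coordinate X i + coordinate Y i"
  and coordinate_diff [simp]: "coordinate (X - Y) i = coordinate X i - coordinate Y i"
  and coordinate_scaleR [simp]: "coordinate (c *\<^sub>R X) i = c * coordinate X i"
  and coordinate_minus [simp]: "coordinate (- X) i = - coordinate X i"
  and coordinate_zero [simp]: "coordinate 0 i = 0"
  by (simp_all add: coordinate_def)

text \<open>
  The flat form \<open>dx\<^sup>2 - dy\<^sup>2\<close>, which ignores the coordinate \<open>z\<close>.  Being defined on all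
  of \<open>\<real>\<^sup>p\<^sup>+\<^sup>q\<close>, it applies to a point \<open>(u, z)\<close> without extracting \<open>u\<close> first.
\<close>

definition horizontal_form :: "nat \<Rightarrow> nat \<Rightarrow> real ^ 'm::finite \<Rightarrow> real ^ 'm \<Rightarrow> real" where
  "horizontal_form p q v w =
     (\<Sum>i=1..<p. coordinate v i * coordinate w i) - (\<Sum>i=p..<p+q. coordinate v i * coordinate w i)"

text \<open>
  The null coordinates \<open>s\<close> and \<open>t\<close>: the pairings with the null vectors \<open>e\<close> and \<open>o\<close> below, up to the
  factor \<open>-2\<close>.
\<close>

definition infinity_height :: "nat \<Rightarrow> nat \<Rightarrow> real ^ 'n::finite \<Rightarrow> real" where
  "infinity_height p q X = coordinate X p + coordinate X (p + q + 1)"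

definition origin_height :: "nat \<Rightarrow> nat \<Rightarrow> real ^ 'n::finite \<Rightarrow> real" where
  "origin_height p q X = coordinate X (p + q + 1) - coordinate X p"

text \<open>
  The null vectors \<open>e\<close> and \<open>o\<close>, dual to \<open>t\<close> and \<open>s\<close>.  They span the two points at infinity of the
  vertical line \<open>u = 0\<close>, reached as \<open>z\<close> tends to \<open>\<infinity>\<close> and to \<open>0\<close> respectively.
\<close>

definition ideal_infinity :: "nat \<Rightarrow> nat \<Rightarrow> real ^ 'n::finite" where
  "ideal_infinity p q = of_coordinates (\<lambda>i. if i = p then - 1 / 2 else if i = p + q + 1 then 1 / 2 else 0)"

definition ideal_origin :: "nat \<Rightarrow> nat \<Rightarrow> real ^ 'n::finite" where
  "ideal_origin p q = of_coordinates (\<lambda>i. if i = p \<or> i = p + q + 1 then 1 / 2 else 0)"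

definition vertical :: "nat \<Rightarrow> nat \<Rightarrow> real ^ 'm::finite" where
  "vertical p q = of_coordinates (\<lambda>i. if i = p + q then 1 else 0)"

text \<open>
  Both spaces contain the horizontal space \<open>\<real>\<^sup>p\<^sup>-\<^sup>1 \<oplus> \<real>\<^sup>q\<close>.  In the ambient space the coordinate \<open>p\<close>
  separates its two summands, so the coordinates \<open>y\<close> are shifted by one.  Each of \<open>inject\<close> and \<open>project\<close>
  reads off the horizontal part of its argument and sets all other coordinates to \<open>0\<close>.
\<close>

definition inject :: "nat \<Rightarrow> nat \<Rightarrow> real ^ 'm::finite \<Rightarrow> real ^ 'n::finite" where
  "inject p q u = of_coordinates (\<lambda>i.
     if i < p then coordinate u i else if p < i \<and> i < p + q + 1 then coordinate u (i - 1) else 0)"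

definition project :: "nat \<Rightarrow> nat \<Rightarrow> real ^ 'n::finite \<Rightarrow> real ^ 'm::finite" where
  "project p q X = of_coordinates (\<lambda>i.
     if i < p then coordinate X i else if i < p + q then coordinate X (i + 1) else 0)"

definition lift :: "nat \<Rightarrow> nat \<Rightarrow> real ^ 'm::finite \<Rightarrow> real ^ 'n::finite" where
  "lift p q u = (let z = coordinate u (p + q) in
     inverse z *\<^sub>R (inject p q u + ideal_origin p q)
     + (z + inverse z * horizontal_form p q u u) *\<^sub>R ideal_infinity p q)"

text \<open>
  The absolute value makes \<open>unlift\<close> agree on \<open>X\<close> and \<open>-X\<close>, so that it descends to the quotient.
\<close>

definition unlift :: "nat \<Rightarrow> nat \<Rightarrow> real ^ 'n::finite \<Rightarrow> real ^ 'm::finite" where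
  "unlift p q X = inverse (infinity_height p q X) *\<^sub>R project p q X
     + inverse \<bar>infinity_height p q X\<bar> *\<^sub>R vertical p q"

lemma infinity_height_simps [simp]:
  "infinity_height p q (X + Y) = infinity_height p q X + infinity_height p q Y"
  "infinity_height p q (c *\<^sub>R X) = c * infinity_height p q X"
  "infinity_height p q (- X) = - infinity_height p q X"
  by (simp_all add: infinity_height_def algebra_simps)

lemma form_add_left: "form a b (X + Y) Z = form a b X Z + form a b Y Z"
  by (simp add: form_def algebra_simps sum.distrib)

lemma form_scaleR_left: "form a b (c *\<^sub>R X) Y = c * form a b X Y"
  by (simp add: form_def algebra_simps sum_distrib_left)

lemma form_commute: "form a b X Y = form a b Y X"
  by (simp add: form_def mult.commute)

lemma form_add_right: "form a b Z (X + Y) = form a b Z X + form a b Z Y"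
  by (simp add: form_commute[of a b Z] form_add_left)

lemma form_scaleR_right: "form a b Y (c *\<^sub>R X) = c * form a b Y X"
  by (simp add: form_commute[of a b Y] form_scaleR_left)

lemma horizontal_form_add_left:
    "horizontal_form p q (u + v) w = horizontal_form p q u w + horizontal_form p q v w"
  by (simp add: horizontal_form_def algebra_simps sum.distrib)

lemma horizontal_form_scaleR_left: "horizontal_form p q (c *\<^sub>R u) v = c * horizontal_form p q u v"
  by (simp add: horizontal_form_def algebra_simps sum_distrib_left)

lemma horizontal_form_commute: "horizontal_form p q u v = horizontal_form p q v u"
  by (simp add: horizontal_form_def mult.commute)

lemma horizontal_form_add_right:
    "horizontal_form p q w (u + v) = horizontal_form p q w u + horizontal_form p q w v"
  by (simp add: horizontal_form_commute[of p q w] horizontal_form_add_left)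

lemma horizontal_form_scaleR_right: "horizontal_form p q v (c *\<^sub>R u) = c * horizontal_form p q v u"
  by (simp add: horizontal_form_commute[of p q v] horizontal_form_scaleR_left)

lemma bounded_bilinear_horizontal_form: "bounded_bilinear (horizontal_form p q)"
  unfolding bilinear_conv_bounded_bilinear[symmetric] bilinear_def
  by (auto intro!: linearI simp: horizontal_form_add_left horizontal_form_scaleR_left
      horizontal_form_add_right horizontal_form_scaleR_right)

lemma bounded_linear_coordinate: "bounded_linear (\<lambda>X. coordinate X i)"
  unfolding coordinate_def by (rule bounded_linear_vec_nth)

lemma bounded_linear_infinity_height: "bounded_linear (infinity_height p q)"
  unfolding linear_conv_bounded_linear[symmetric] by (rule linearI) simp_all

lemma form_null_coordinates:
  assumes "p \<ge> 1"
  shows "form p (q + 1) X Y =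
    (\<Sum>i=1..<p. coordinate X i * coordinate Y i)
    - (\<Sum>i=p..<p+q. coordinate X (i + 1) * coordinate Y (i + 1))
    - (infinity_height p q X * origin_height p q Y + origin_height p q X * infinity_height p q Y) / 2"
proof -
  have "{1..p} = insert p {1..<p}"
    using assms by auto
  then have 1: "(\<Sum>i=1..p. coordinate X i * coordinate Y i) =
      (\<Sum>i=1..<p. coordinate X i * coordinate Y i) + coordinate X p * coordinate Y p"
    by simp
  have "{p+1..p+(q+1)} = insert (p + q + 1) {p+1..<p+q+1}"
    by auto
  then have "(\<Sum>i=p+1..p+(q+1). coordinate X i * coordinate Y i) =
      (\<Sum>i=p+1..<p+q+1. coordinate X i * coordinate Y i)
      + coordinate X (p + q + 1) * coordinate Y (p + q + 1)"
    by simp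
  also have "(\<Sum>i=p+1..<p+q+1. coordinate X i * coordinate Y i) =
      (\<Sum>i=p..<p+q. coordinate X (i + 1) * coordinate Y (i + 1))"
    by (rule sum.shift_bounds_nat_ivl)
  finally show ?thesis
    using 1 by (simp add: form_def infinity_height_def origin_height_def field_simps)
qed

context
  fixes p q :: nat
  assumes p: "p \<ge> 1"
    and card_m: "CARD('m::finite) = p + q"
    and card_n: "CARD('n::finite) = p + q + 1"
begin

text \<open>
  Index ranges are split into blocks once and for all: the coordinates \<open>x\<close>, the coordinates \<open>y\<close>
  (indexed by their position in the half-space), and the remaining special ones.
\<close>

lemma source_eqI:
  fixes u v :: "real ^ 'm"
  assumes "\<And>i. 1 \<le> i \<Longrightarrow> i < p \<Longrightarrow> coordinate u i = coordinate v i"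
    and "\<And>i. p \<le> i \<Longrightarrow> i < p + q \<Longrightarrow> coordinate u i = coordinate v i"
    and "coordinate u (p + q) = coordinate v (p + q)"
  shows "u = v"
proof (rule coordinate_eqI)
  fix i assume "1 \<le> i" "i \<le> CARD('m)"
  then consider "1 \<le> i" "i < p" | "p \<le> i" "i < p + q" | "i = p + q"
    unfolding card_m by linarith
  then show "coordinate u i = coordinate v i"
    by cases (use assms in auto)
qed

lemma target_eqI:
  fixes X Y :: "real ^ 'n"
  assumes "\<And>i. 1 \<le> i \<Longrightarrow> i < p \<Longrightarrow> coordinate X i = coordinate Y i"
    and "coordinate X p = coordinate Y p"
    and "\<And>i. p \<le> i \<Longrightarrow> i < p + q \<Longrightarrow> coordinate X (i + 1) = coordinate Y (i + 1)"
    and "coordinate X (p + q + 1) = coordinate Y (p + q + 1)"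
  shows "X = Y"
proof (rule coordinate_eqI)
  fix i assume "1 \<le> i" "i \<le> CARD('n)"
  then consider "1 \<le> i" "i < p" | "i = p" | "p \<le> i - 1" "i - 1 < p + q" "i = i - 1 + 1"
      | "i = p + q + 1"
    unfolding card_n by linarith
  then show "coordinate X i = coordinate Y i"
  proof cases
    case 3
    with assms(3)[of "i - 1"] show ?thesis
      by simp
  qed (use assms in auto)
qed

lemma coordinate_inject:
  fixes u :: "real ^ 'm"
  shows "1 \<le> i \<Longrightarrow> i < p \<Longrightarrow> coordinate (inject p q u :: real ^ 'n) i = coordinate u i"
    and "coordinate (inject p q u :: real ^ 'n) p = 0"
    and "p \<le> i \<Longrightarrow> i < p + q \<Longrightarrow> coordinate (inject p q u :: real ^ 'n) (i + 1) = coordinate u i"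
    and "coordinate (inject p q u :: real ^ 'n) (p + q + 1) = 0"
  unfolding inject_def using p by (simp_all add: coordinate_of_coordinates card_n)

lemma coordinate_project:
  fixes X :: "real ^ 'n"
  shows "1 \<le> i \<Longrightarrow> i < p \<Longrightarrow> coordinate (project p q X :: real ^ 'm) i = coordinate X i"
    and "p \<le> i \<Longrightarrow> i < p + q \<Longrightarrow> coordinate (project p q X :: real ^ 'm) i = coordinate X (i + 1)"
    and "coordinate (project p q X :: real ^ 'm) (p + q) = 0"
  unfolding project_def using p by (simp_all add: coordinate_of_coordinates card_m)

lemma coordinate_vertical:
  "1 \<le> i \<Longrightarrow> i < p + q \<Longrightarrow> coordinate (vertical p q :: real ^ 'm) i = 0"
  "coordinate (vertical p q :: real ^ 'm) (p + q) = 1"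
  unfolding vertical_def using p by (simp_all add: coordinate_of_coordinates card_m)

lemma coordinate_ideal_infinity:
  "1 \<le> i \<Longrightarrow> i < p \<Longrightarrow> coordinate (ideal_infinity p q :: real ^ 'n) i = 0"
  "coordinate (ideal_infinity p q :: real ^ 'n) p = - 1 / 2"
  "p \<le> i \<Longrightarrow> i < p + q \<Longrightarrow> coordinate (ideal_infinity p q :: real ^ 'n) (i + 1) = 0"
  "coordinate (ideal_infinity p q :: real ^ 'n) (p + q + 1) = 1 / 2"
  unfolding ideal_infinity_def using p by (simp_all add: coordinate_of_coordinates card_n)

lemma coordinate_ideal_origin:
  "1 \<le> i \<Longrightarrow> i < p \<Longrightarrow> coordinate (ideal_origin p q :: real ^ 'n) i = 0"
  "coordinate (ideal_origin p q :: real ^ 'n) p = 1 / 2"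
  "p \<le> i \<Longrightarrow> i < p + q \<Longrightarrow> coordinate (ideal_origin p q :: real ^ 'n) (i + 1) = 0"
  "coordinate (ideal_origin p q :: real ^ 'n) (p + q + 1) = 1 / 2"
  unfolding ideal_origin_def using p by (simp_all add: coordinate_of_coordinates card_n)

lemmas coordinates = coordinate_inject coordinate_project coordinate_vertical
  coordinate_ideal_infinity coordinate_ideal_origin

lemma bounded_linear_inject: "bounded_linear (inject p q :: real ^ 'm \<Rightarrow> real ^ 'n)"
  unfolding linear_conv_bounded_linear[symmetric]
  by (rule linearI; rule target_eqI) (simp_all only: coordinates coordinate_add coordinate_scaleR)

lemma bounded_linear_project: "bounded_linear (project p q :: real ^ 'n \<Rightarrow> real ^ 'm)"
  unfolding linear_conv_bounded_linear[symmetric]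
  by (rule linearI; rule source_eqI) (simp_all only: coordinates coordinate_add coordinate_scaleR)

lemma heights:
  fixes u :: "real ^ 'm"
  shows "infinity_height p q (inject p q u :: real ^ 'n) = 0"
    and "origin_height p q (inject p q u :: real ^ 'n) = 0"
    and "infinity_height p q (ideal_infinity p q :: real ^ 'n) = 0"
    and "origin_height p q (ideal_infinity p q :: real ^ 'n) = 1"
    and "infinity_height p q (ideal_origin p q :: real ^ 'n) = 1"
    and "origin_height p q (ideal_origin p q :: real ^ 'n) = 0"
  unfolding infinity_height_def origin_height_def coordinates by simp_all

text \<open>The formula \<open>\<langle>X, X\<rangle> = h(w, w) - s t\<close> in polarised form.\<close>

lemma form_decompose:
  fixes X Y :: "real ^ 'n"
  shows "form p (q + 1) X Y = horizontal_form p q (project p q X :: real ^ 'm) (project p q Y)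
    - (infinity_height p q X * origin_height p q Y + origin_height p q X * infinity_height p q Y) / 2"
proof -
  have "(\<Sum>i=1..<p. coordinate X i * coordinate Y i) =
    (\<Sum>i=1..<p. coordinate (project p q X :: real ^ 'm) i * coordinate (project p q Y :: real ^ 'm) i)"
    by (intro sum.cong refl) (simp only: coordinates atLeastLessThan_iff)
  moreover have "(\<Sum>i=p..<p+q. coordinate X (i + 1) * coordinate Y (i + 1)) =
    (\<Sum>i=p..<p+q. coordinate (project p q X :: real ^ 'm) i * coordinate (project p q Y :: real ^ 'm) i)"
    by (intro sum.cong refl) (simp only: coordinates atLeastLessThan_iff)
  ultimately show ?thesis
    by (simp only: form_null_coordinates[OF p] horizontal_form_def)
qed

lemma project_ideal:
  "project p q (ideal_infinity p q :: real ^ 'n) = (0 :: real ^ 'm)"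
  "project p q (ideal_origin p q :: real ^ 'n) = (0 :: real ^ 'm)"
  by (rule source_eqI; simp only: coordinates coordinate_zero)+

lemma project_inject:
  fixes u :: "real ^ 'm"
  shows "project p q (inject p q u :: real ^ 'n) = u - coordinate u (p + q) *\<^sub>R vertical p q"
  using p by (intro source_eqI) (simp_all add: coordinates coordinates[folded Suc_eq_plus1])

lemma inject_project:
  fixes X :: "real ^ 'n"
  shows "inject p q (project p q X :: real ^ 'm) =
    X - infinity_height p q X *\<^sub>R ideal_origin p q - origin_height p q X *\<^sub>R ideal_infinity p q"
  by (rule target_eqI)
    (simp_all only: coordinates coordinate_diff coordinate_scaleR infinity_height_def
      origin_height_def, simp_all add: field_simps)

lemma horizontal_form_vertical:
  fixes u :: "real ^ 'm"
  shows "horizontal_form p q (vertical p q) u = 0" and "horizontal_form p q u (vertical p q) = 0"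
  using p by (auto simp: horizontal_form_def coordinate_vertical intro!: sum.neutral)

lemma inject_vertical: "inject p q (vertical p q :: real ^ 'm) = (0 :: real ^ 'n)"
  using p by (intro target_eqI) (simp_all add: coordinates coordinates[folded Suc_eq_plus1])


text \<open>
  The Gram matrix of the decomposition into the horizontal space, \<open>o\<close> and \<open>e\<close>.  With it, every pairing
  of vectors written in this decomposition becomes a polynomial identity.
\<close>

lemma form_null_frame:
  fixes u v :: "real ^ 'm"
  shows "form p (q + 1) (inject p q u :: real ^ 'n) (inject p q v) = horizontal_form p q u v"
    and "form p (q + 1) (inject p q u :: real ^ 'n) (ideal_infinity p q) = 0"
    and "form p (q + 1) (ideal_infinity p q) (inject p q u :: real ^ 'n) = 0"
    and "form p (q + 1) (inject p q u :: real ^ 'n) (ideal_origin p q) = 0"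
    and "form p (q + 1) (ideal_origin p q) (inject p q u :: real ^ 'n) = 0"
    and "form p (q + 1) (ideal_infinity p q :: real ^ 'n) (ideal_infinity p q) = 0"
    and "form p (q + 1) (ideal_origin p q :: real ^ 'n) (ideal_origin p q) = 0"
    and "form p (q + 1) (ideal_infinity p q :: real ^ 'n) (ideal_origin p q) = - 1 / 2"
    and "form p (q + 1) (ideal_origin p q :: real ^ 'n) (ideal_infinity p q) = - 1 / 2"
proof -
  have "horizontal_form p q (u - c *\<^sub>R vertical p q) (v - d *\<^sub>R vertical p q) = horizontal_form p q u v" for c d
    unfolding bounded_bilinear.diff_left[OF bounded_bilinear_horizontal_form]
      bounded_bilinear.diff_right[OF bounded_bilinear_horizontal_form]
      horizontal_form_scaleR_left horizontal_form_scaleR_right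
    by (simp add: horizontal_form_vertical)
  then show "form p (q + 1) (inject p q u :: real ^ 'n) (inject p q v) = horizontal_form p q u v"
    by (simp only: form_decompose heights project_inject mult_zero_left mult_zero_right) simp
  have 0: "horizontal_form p q (0 :: real ^ 'm) w = 0" "horizontal_form p q w (0 :: real ^ 'm) = 0" for w
    by (simp_all add: horizontal_form_def)
  show "form p (q + 1) (inject p q u :: real ^ 'n) (ideal_infinity p q) = 0"
    and "form p (q + 1) (ideal_infinity p q) (inject p q u :: real ^ 'n) = 0"
    and "form p (q + 1) (inject p q u :: real ^ 'n) (ideal_origin p q) = 0"
    and "form p (q + 1) (ideal_origin p q) (inject p q u :: real ^ 'n) = 0"
    and "form p (q + 1) (ideal_infinity p q :: real ^ 'n) (ideal_infinity p q) = 0"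
    and "form p (q + 1) (ideal_origin p q :: real ^ 'n) (ideal_origin p q) = 0"
    and "form p (q + 1) (ideal_infinity p q :: real ^ 'n) (ideal_origin p q) = - 1 / 2"
    and "form p (q + 1) (ideal_origin p q :: real ^ 'n) (ideal_infinity p q) = - 1 / 2"
    by (simp_all only: form_decompose heights project_ideal 0, simp_all)
qed

lemmas form_expand = form_add_left form_add_right form_scaleR_left form_scaleR_right form_null_frame

section \<open>The half-space parametrisation and its metric\<close>

lemma lift_in_quadric:
  fixes u :: "real ^ 'm"
  assumes "coordinate u (p + q) \<noteq> 0"
  shows "(lift p q u :: real ^ 'n) \<in> quadric p q"
  using assms unfolding quadric_def lift_def Let_def mem_Collect_eq form_expand
  by (simp add: field_simps)

lemma open_half_space: "open (half_space p q :: (real ^ 'm) set)"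
  unfolding half_space_def coordinate_def by (intro open_Collect_less continuous_intros)

lemma smooth_on_lift: "smooth_on (lift p q :: real ^ 'm \<Rightarrow> real ^ 'n) (half_space p q)"
proof -
  let ?U = "half_space p q :: (real ^ 'm) set"
  have z: "Ck_on k (\<lambda>u. coordinate u (p + q)) ?U" for k
    by (rule Ck_on_linear[OF bounded_linear_coordinate])
  have i: "Ck_on k (\<lambda>u. inverse (coordinate u (p + q))) ?U" for k
    by (rule Ck_on_inverse[OF open_half_space _ z]) (simp add: half_space_def)
  have "Ck_on k (\<lambda>u. u) ?U" for k
    by (rule Ck_on_linear[OF bounded_linear_ident])
  then have h: "Ck_on k (\<lambda>u. horizontal_form p q u u) ?U" for k
    by (intro Ck_on_bilinear[OF bounded_bilinear_horizontal_form open_half_space])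
  have "Ck_on k (lift p q :: real ^ 'm \<Rightarrow> real ^ 'n) ?U" for k
    unfolding lift_def Let_def
    by (intro Ck_on_add[OF open_half_space] Ck_on_bilinear[OF bounded_bilinear_scaleR open_half_space]
        Ck_on_bilinear[OF bounded_bilinear_mult open_half_space]
        Ck_on_linear[OF bounded_linear_inject] Ck_on_const z i h)
  then show ?thesis
    by (simp add: smooth_on_def)
qed

text \<open>
  The derivative is written with powers of \<open>i = 1 / z\<close> instead of quotients: the isometry property then
  is an identity of polynomials in \<open>i\<close>, the coordinates and the values of \<open>h\<close>.
\<close>

lemma lift_has_derivative:
  fixes u :: "real ^ 'm"
  defines "i \<equiv> inverse (coordinate u (p + q))"
  assumes "coordinate u (p + q) \<noteq> 0"
  shows "((lift p q :: real ^ 'm \<Rightarrow> real ^ 'n) has_derivative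
    (\<lambda>v. i *\<^sub>R inject p q v
      + (- (coordinate v (p + q) * i\<^sup>2)) *\<^sub>R (inject p q u + ideal_origin p q)
      + (coordinate v (p + q) + 2 * horizontal_form p q u v * i
          - coordinate v (p + q) * horizontal_form p q u u * i\<^sup>2) *\<^sub>R ideal_infinity p q)) (at u)"
proof -
  have z: "((\<lambda>u :: real ^ 'm. coordinate u (p + q)) has_derivative (\<lambda>v. coordinate v (p + q))) (at u)"
    by (rule bounded_linear_imp_has_derivative[OF bounded_linear_coordinate])
  have inverse_z: "((\<lambda>u :: real ^ 'm. inverse (coordinate u (p + q))) has_derivative
      (\<lambda>v. - (coordinate v (p + q) * i\<^sup>2))) (at u)"
    using Deriv.has_derivative_inverse[OF assms(2) z]
    by (simp add: i_def power2_eq_square ac_simps)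
  have h: "((\<lambda>u. horizontal_form p q u u) has_derivative (\<lambda>v. 2 * horizontal_form p q u v)) (at u)"
    by (rule has_derivative_eq_rhs, rule bounded_bilinear.FDERIV[OF bounded_bilinear_horizontal_form],
        (rule has_derivative_ident)+) (simp add: fun_eq_iff horizontal_form_commute[of p q u])
  have "((inject p q :: real ^ 'm \<Rightarrow> real ^ 'n) has_derivative inject p q) (at u)"
    by (rule bounded_linear_imp_has_derivative[OF bounded_linear_inject])
  then have spatial: "((\<lambda>u :: real ^ 'm. inject p q u + ideal_origin p q :: real ^ 'n)
      has_derivative inject p q) (at u)"
    using has_derivative_add_const by blast
  have coefficient: "((\<lambda>u. coordinate u (p + q) + inverse (coordinate u (p + q)) * horizontal_form p q u u)
      has_derivative (\<lambda>v. coordinate v (p + q) + 2 * horizontal_form p q u v * i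
          - coordinate v (p + q) * horizontal_form p q u u * i\<^sup>2)) (at u)"
    by (rule has_derivative_eq_rhs[OF has_derivative_add[OF z has_derivative_mult[OF inverse_z h]]])
      (simp add: fun_eq_iff i_def)
  show ?thesis
    unfolding lift_def Let_def
    by (rule has_derivative_eq_rhs[OF has_derivative_add[OF has_derivative_scaleR[OF inverse_z spatial]
            has_derivative_scaleR[OF coefficient has_derivative_const]]])
      (simp add: fun_eq_iff i_def)
qed

text \<open>
  With \<open>\<zeta>\<close> the vertical component of a tangent vector \<open>v\<close>, the derivative has horizontal part
  \<open>v / z - \<zeta> u / z\<^sup>2\<close>.  The terms in \<open>h(u, u)\<close>, \<open>h(u, v)\<close> and \<open>h(u, w)\<close> that it produces are cancelled by the
  pairing of \<open>o\<close> with \<open>e\<close>.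
\<close>

lemma lift_isometry:
  fixes u v w :: "real ^ 'm"
  defines "D \<equiv> frechet_derivative (lift p q :: real ^ 'm \<Rightarrow> real ^ 'n) (at u)"
  assumes "coordinate u (p + q) \<noteq> 0"
  shows "form p (q + 1) (D v) (D w) = half_space_metric p q u v w"
proof -
  have "form p (q + 1) (D v) (D w) = (horizontal_form p q v w
      + coordinate v (p + q) * coordinate w (p + q)) * (inverse (coordinate u (p + q)))\<^sup>2"
    unfolding D_def frechet_derivative_at[OF lift_has_derivative[OF assms(2)], symmetric]
      form_expand horizontal_form_commute[of p q v u]
    by (simp add: algebra_simps power2_eq_square add_divide_distrib)
  then show ?thesis
    by (simp add: half_space_metric_def horizontal_form_def field_simps)
qed

lemmas expand_projections =
  linear_add[OF bounded_linear.linear[OF bounded_linear_project]]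
  linear_scale[OF bounded_linear.linear[OF bounded_linear_project]]
  project_inject project_ideal infinity_height_simps heights

lemma inj_lift_derivative:
  fixes u :: "real ^ 'm"
  assumes "coordinate u (p + q) \<noteq> 0"
  shows "inj (frechet_derivative (lift p q :: real ^ 'm \<Rightarrow> real ^ 'n) (at u))"
proof (rule injI)
  let ?D = "frechet_derivative (lift p q :: real ^ 'm \<Rightarrow> real ^ 'n) (at u)"
  fix v w assume eq: "?D v = ?D w"
  let ?z = "coordinate u (p + q)"
  have "infinity_height p q (?D v) = infinity_height p q (?D w)"
    by (simp only: eq)
  \<comment> \<open>The coordinate \<open>s = 1 / z\<close> sees the vertical component alone; the horizontal part gives the rest.\<close>
  then have z: "coordinate v (p + q) = coordinate w (p + q)"
    unfolding frechet_derivative_at[OF lift_has_derivative[OF assms], symmetric] expand_projections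
    using assms by simp
  have "(project p q (?D v) :: real ^ 'm) = project p q (?D w)"
    by (simp only: eq)
  then show "v = w"
    unfolding frechet_derivative_at[OF lift_has_derivative[OF assms], symmetric] expand_projections
      z using assms by simp
qed

section \<open>The inverse parametrisation\<close>

lemma infinity_height_lift:
  fixes u :: "real ^ 'm"
  shows "infinity_height p q (lift p q u :: real ^ 'n) = inverse (coordinate u (p + q))"
  unfolding lift_def Let_def expand_projections by simp

lemma unlift_lift:
  fixes u :: "real ^ 'm"
  assumes "coordinate u (p + q) > 0"
  shows "unlift p q (lift p q u :: real ^ 'n) = u"
  unfolding unlift_def infinity_height_lift
  unfolding lift_def Let_def expand_projections using assms by simp

lemma coordinate_unlift:
  fixes X :: "real ^ 'n"
  shows "coordinate (unlift p q X :: real ^ 'm) (p + q) = inverse \<bar>infinity_height p q X\<bar>"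
  by (simp add: unlift_def coordinates)

lemma unlift_minus:
  fixes X :: "real ^ 'n"
  shows "(unlift p q (- X) :: real ^ 'm) = unlift p q X"
  by (simp add: unlift_def linear_neg[OF bounded_linear.linear[OF bounded_linear_project]])

text \<open>
  \<open>F\<close> reproduces \<open>s\<close> and \<open>w\<close> by construction; the remaining coordinate \<open>t\<close> agrees because both points
  satisfy \<open>s t = 1 + h(w, w)\<close>.
\<close>

lemma lift_unlift_pos:
  fixes X :: "real ^ 'n"
  assumes "X \<in> quadric p q" "infinity_height p q X > 0"
  shows "lift p q (unlift p q X :: real ^ 'm) = X"
proof -
  let ?s = "infinity_height p q X" and ?t = "origin_height p q X" and ?x = "project p q X :: real ^ 'm"
  let ?u = "unlift p q X :: real ^ 'm"
  have u: "?u = inverse ?s *\<^sub>R ?x + inverse ?s *\<^sub>R vertical p q"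
    using assms by (simp add: unlift_def)
  have inj: "inject p q ?u = inverse ?s *\<^sub>R (X - ?s *\<^sub>R ideal_origin p q - ?t *\<^sub>R ideal_infinity p q)"
    unfolding u linear_add[OF bounded_linear.linear[OF bounded_linear_inject]]
      linear_scale[OF bounded_linear.linear[OF bounded_linear_inject]] inject_vertical inject_project
    by simp
  have "horizontal_form p q ?u ?u = (inverse ?s)\<^sup>2 * horizontal_form p q ?x ?x"
    unfolding u horizontal_form_add_left horizontal_form_add_right horizontal_form_scaleR_left
      horizontal_form_scaleR_right horizontal_form_vertical
    by (simp add: power2_eq_square)
  also have "horizontal_form p q ?x ?x = ?s * ?t - 1"
    using assms(1) form_decompose[of X X] by (simp add: quadric_def)
  finally have "inverse ?s + ?s * horizontal_form p q ?u ?u = ?t"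
    using assms(2) by (simp add: field_simps power2_eq_square)
  then show ?thesis
    unfolding lift_def Let_def inj coordinate_unlift
    using assms(2) by (simp add: algebra_simps)
qed

lemma proj_lift_unlift:
  fixes X :: "real ^ 'n"
  assumes "X \<in> quadric p q" "infinity_height p q X \<noteq> 0"
  shows "proj (lift p q (unlift p q X :: real ^ 'm)) = proj X"
proof (cases "infinity_height p q X > 0")
  case True
  with assms show ?thesis
    by (simp add: lift_unlift_pos)
next
  case False
  have "- X \<in> quadric p q" "infinity_height p q (- X) > 0"
    using assms False by (simp_all add: quadric_def form_minus_minus)
  then have "lift p q (unlift p q X :: real ^ 'm) = - X"
    using lift_unlift_pos unlift_minus by metis
  then show ?thesis
    by (auto simp: proj_def)
qed


section \<open>The embedding into the quotient\<close>

lemma local_lift_lift: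
  "local_lift p q (\<lambda>u :: real ^ 'm. proj (lift p q u :: real ^ 'n)) (lift p q) (half_space p q)"
  using open_half_space smooth_on_lift lift_in_quadric
  by (auto simp: local_lift_def half_space_def)

text \<open>
  For \<open>S\<close> the whole half-space this computes the image of the embedding; for open \<open>S\<close> it shows that the
  embedding is an open map, as the right-hand side is the projection of the preimage of \<open>S\<close> under the
  continuous map \<open>unlift\<close>, and this preimage is invariant under \<open>-Id\<close>.
\<close>

lemma image_proj_lift:
  "(\<lambda>u. proj (lift p q u :: real ^ 'n)) ` S
    = proj ` {X \<in> quadric p q. infinity_height p q X \<noteq> 0 \<and> unlift p q X \<in> S}"
  if "S \<subseteq> half_space p q" for S :: "(real ^ 'm) set"
proof safe
  fix u assume "u \<in> S"
  then have "coordinate u (p + q) > 0"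
    using that by (auto simp: half_space_def)
  with \<open>u \<in> S\<close> show "proj (lift p q u :: real ^ 'n)
      \<in> proj ` {X \<in> quadric p q. infinity_height p q X \<noteq> 0 \<and> unlift p q X \<in> S}"
    by (auto intro!: imageI simp: lift_in_quadric unlift_lift infinity_height_lift)
next
  fix X :: "real ^ 'n"
  assume "X \<in> quadric p q" "infinity_height p q X \<noteq> 0" "(unlift p q X :: real ^ 'm) \<in> S"
  then show "proj X \<in> (\<lambda>u. proj (lift p q u :: real ^ 'n)) ` S"
    by (metis (no_types, lifting) image_eqI proj_lift_unlift)
qed

lemma inj_on_proj_lift: "inj_on (\<lambda>u :: real ^ 'm. proj (lift p q u :: real ^ 'n)) (half_space p q)"
proof (rule inj_onI)
  fix u v :: "real ^ 'm"
  assume uv: "u \<in> half_space p q" "v \<in> half_space p q"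
    and "proj (lift p q u :: real ^ 'n) = proj (lift p q v)"
  then have "(unlift p q (lift p q u :: real ^ 'n) :: real ^ 'm) = unlift p q (lift p q v :: real ^ 'n)"
    by (auto simp: proj_def doubleton_eq_iff unlift_minus)
  with uv show "u = v"
    by (simp add: unlift_lift half_space_def)
qed

lemma continuous_on_unlift:
  "continuous_on {X :: real ^ 'n. infinity_height p q X \<noteq> 0} (unlift p q :: _ \<Rightarrow> real ^ 'm)"
  unfolding unlift_def
  by (intro continuous_intros linear_continuous_on[OF bounded_linear_infinity_height]
      linear_continuous_on[OF bounded_linear_project]) auto

lemma unlift_in_half_space:
  fixes X :: "real ^ 'n"
  shows "infinity_height p q X \<noteq> 0 \<Longrightarrow> (unlift p q X :: real ^ 'm) \<in> half_space p q"
  by (simp add: half_space_def coordinate_unlift)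

lemma embedding_map_proj_lift:
  "embedding_map (top_of_set (half_space p q :: (real ^ 'm) set)) (hyp_topology p q)
     (\<lambda>u. proj (lift p q u :: real ^ 'n))"
proof (rule injective_open_imp_embedding_map)
  let ?U = "half_space p q :: (real ^ 'm) set" and ?f = "\<lambda>u :: real ^ 'm. proj (lift p q u :: real ^ 'n)"
  have quadric: "lift p q ` ?U \<subseteq> (quadric p q :: (real ^ 'n) set)"
    using lift_in_quadric by (auto simp: half_space_def)
  show "continuous_map (top_of_set ?U) (hyp_topology p q) ?f"
    unfolding continuous_map_def topspace_hyp_topology
  proof (intro conjI allI impI)
    show "?f \<in> topspace (top_of_set ?U) \<rightarrow> hyp p q"
      using quadric by (auto simp: hyp_def)
    fix T :: "(real ^ 'n) set set" assume "openin (hyp_topology p q) T"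
    then have "openin (top_of_set (quadric p q)) {X \<in> quadric p q. proj X \<in> T}"
      by (simp add: openin_hyp_topology)
    then have "openin (top_of_set ?U) (?U \<inter> lift p q -` {X \<in> quadric p q. proj X \<in> T})"
      by (rule continuous_openin_preimage[OF smooth_on_imp_continuous_on[OF smooth_on_lift]
            quadric[THEN image_subset_iff_funcset[THEN iffD1]]])
    moreover have "?U \<inter> lift p q -` {X \<in> quadric p q. proj X \<in> T}
        = {u \<in> topspace (top_of_set ?U). ?f u \<in> T}"
      using quadric by auto
    ultimately show "openin (top_of_set ?U) {u \<in> topspace (top_of_set ?U). ?f u \<in> T}"
      by simp
  qed
  show "open_map (top_of_set ?U) (hyp_topology p q) ?f"
    unfolding open_map_def
  proof (intro allI impI)
    fix S assume S: "openin (top_of_set ?U) S"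
    then have "open S" "S \<subseteq> ?U"
      using open_half_space openin_open_eq by auto
    let ?N = "{X :: real ^ 'n. infinity_height p q X \<noteq> 0}"
    have "open ?N"
      by (intro open_Collect_neq linear_continuous_on[OF bounded_linear_infinity_height] continuous_intros)
    then have "open (?N \<inter> unlift p q -` S)"
      by (intro continuous_open_preimage[OF continuous_on_unlift] \<open>open S\<close>)
    moreover have "{X \<in> quadric p q. proj X \<in> ?f ` S} = quadric p q \<inter> (?N \<inter> unlift p q -` S)"
      unfolding image_proj_lift[OF \<open>S \<subseteq> ?U\<close>]
      by (auto simp: proj_def doubleton_eq_iff unlift_minus image_iff)
    ultimately have "openin (top_of_set (quadric p q)) {X \<in> quadric p q. proj X \<in> ?f ` S}"
      by (simp add: openin_open_Int)
    moreover have "?f ` S \<subseteq> hyp p q"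
      using quadric \<open>S \<subseteq> ?U\<close> by (auto simp: hyp_def)
    ultimately show "openin (hyp_topology p q) (?f ` S)"
      by (simp add: openin_hyp_topology)
  qed
  show "inj_on ?f (topspace (top_of_set ?U))"
    using inj_on_proj_lift by simp
qed

text \<open>
  \<open>F\<close> is a lift defined on the whole half-space, so the differential and the metric of the quotient are
  those of \<open>F\<close> as a map into the ambient space.
\<close>

lemma isometric_embedding_proj_lift:
  "isometric_embedding p q (half_space p q) (half_space_metric p q)
     (\<lambda>u :: real ^ 'm. proj (lift p q u :: real ^ 'n))"
  unfolding isometric_embedding_def
proof (intro conjI ballI allI)
  let ?f = "\<lambda>u :: real ^ 'm. proj (lift p q u :: real ^ 'n)"
  show "smooth_into_hyp p q (half_space p q) ?f"
    unfolding smooth_into_hyp_def using local_lift_lift by blast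
  show "embedding_map (top_of_set (half_space p q)) (hyp_topology p q) ?f"
    by (rule embedding_map_proj_lift)
  fix u :: "real ^ 'm" assume u: "u \<in> half_space p q"
  then have z: "coordinate u (p + q) \<noteq> 0"
    by (simp add: half_space_def)
  have nonzero: "(lift p q u :: real ^ 'n) \<noteq> 0"
    using lift_in_quadric[OF z] zero_notin_quadric by metis
  note differential = hyp_differential_eq[OF local_lift_lift u]
  show "inj (hyp_differential p q ?f u)"
  proof (rule injI)
    fix v w assume "hyp_differential p q ?f u v = hyp_differential p q ?f u w"
    then have "frechet_derivative (lift p q :: _ \<Rightarrow> real ^ 'n) (at u) v = frechet_derivative (lift p q) (at u) w"
      using nonzero iffD1[OF vec_eq_minus_self_iff, of "lift p q u :: real ^ 'n"]
      unfolding differential tangent_def doubleton_eq_iff by auto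
    then show "v = w"
      using inj_lift_derivative[OF z] by (rule injD[rotated])
  qed
  show "hyp_metric p q (hyp_differential p q ?f u v) (hyp_differential p q ?f u w)
      = half_space_metric p q u v w" for v w
    unfolding differential hyp_metric_tangent[OF nonzero] by (rule lift_isometry[OF z])
qed

lemma image_half_space:
  "(\<lambda>u :: real ^ 'm. proj (lift p q u :: real ^ 'n)) ` half_space p q
     = proj ` {X \<in> quadric p q. infinity_height p q X \<noteq> 0}"
  using image_proj_lift[OF subset_refl] unlift_in_half_space
  by (auto intro!: arg_cong[where f="image proj"])

section \<open>The complement of the image\<close>

text \<open>If \<open>q = 0\<close>, then \<open>h\<close> is positive semidefinite, while \<open>s = 0\<close> would give \<open>h(w, w) = -1\<close>.\<close>

lemma infinity_height_nonzero_if_Riemannian: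
  fixes X :: "real ^ 'n"
  assumes "q = 0" "X \<in> quadric p q"
  shows "infinity_height p q X \<noteq> 0"
proof
  assume "infinity_height p q X = 0"
  then have "horizontal_form p q (project p q X :: real ^ 'm) (project p q X) = - 1"
    using assms(2) form_decompose[of X X] by (simp add: quadric_def)
  moreover have "horizontal_form p q (project p q X :: real ^ 'm) (project p q X) \<ge> 0"
    using assms(1) by (simp add: horizontal_form_def sum_nonneg)
  ultimately show False
    by simp
qed

lemma infinity_height_eq_0_if_same_proj: "proj X = proj Y \<Longrightarrow>
    infinity_height p q X = 0 \<longleftrightarrow> infinity_height p q Y = 0" for X Y :: "real ^ 'n"
  by (auto simp: proj_def doubleton_eq_iff)

lemma linear_hyperplane_infinity:
  "linear_hyperplane {X :: real ^ 'n. infinity_height p q X = 0}"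
proof -
  define a :: "real ^ 'n" where "a = axis (index p) 1 + axis (index (p + q + 1)) 1"
  have a: "infinity_height p q X = a \<bullet> X" for X :: "real ^ 'n"
    by (simp add: a_def infinity_height_def coordinate_def inner_add_left inner_axis')
  then have "a \<noteq> 0"
    using heights(5) by force
  then show ?thesis
    unfolding linear_hyperplane_def a
    by (simp add: subspace_hyperplane dim_hyperplane card_n)
qed

text \<open>
  The vector \<open>e\<close> satisfies \<open>\<langle>e, X\<rangle> = - s / 2\<close>.  So it is orthogonal to the hyperplane \<open>s = 0\<close>, on which it
  lies itself.
\<close>

lemma degenerate_on_infinity:
  "degenerate_on p (q + 1) {X :: real ^ 'n. infinity_height p q X = 0}"
  unfolding degenerate_on_def
proof (intro bexI conjI ballI)
  have "origin_height p q (0 :: real ^ 'n) = 0"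
    by (simp add: origin_height_def)
  then show "(ideal_infinity p q :: real ^ 'n) \<noteq> 0"
    using heights(4) by force
  show "form p (q + 1) (ideal_infinity p q :: real ^ 'n) X = 0"
    if "X \<in> {X. infinity_height p q X = 0}" for X
    using that by (simp only: form_decompose project_ideal heights) (simp add: horizontal_form_def)
qed (simp add: heights)

end

theorem proposition2p5:
  fixes p q :: nat
  assumes "p \<ge> 1"
    and "CARD('m::finite) = p + q"
    and "CARD('n::finite) = p + q + 1"
  shows "\<exists>\<iota> :: real ^ 'm \<Rightarrow> (real ^ 'n) set.
    isometric_embedding p q (half_space p q) (half_space_metric p q) \<iota> \<and>
    (q = 0 \<longrightarrow> \<iota> ` half_space p q = hyp p q) \<and>
    (q \<ge> 1 \<longrightarrow> (\<exists>S. totally_geodesic_degenerate_hyperplane p q S \<and>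
       \<iota> ` half_space p q = hyp p q - S))"
proof (intro exI conjI impI)
  let ?\<iota> = "\<lambda>u :: real ^ 'm. proj (lift p q u :: real ^ 'n)"
  let ?P = "{X :: real ^ 'n. infinity_height p q X = 0}"
  show "isometric_embedding p q (half_space p q) (half_space_metric p q) ?\<iota>"
    by (rule isometric_embedding_proj_lift[OF assms])
  show "?\<iota> ` half_space p q = hyp p q" if "q = 0"
    unfolding image_half_space[OF assms] hyp_def
    using infinity_height_nonzero_if_Riemannian[OF assms that]
    by (intro arg_cong[where f="image proj"]) blast
  show "totally_geodesic_degenerate_hyperplane p q (geodesic_hyperplane p q ?P)"
    unfolding totally_geodesic_degenerate_hyperplane_def
    using linear_hyperplane_infinity[OF assms] degenerate_on_infinity[OF assms] by blast
  show "?\<iota> ` half_space p q = hyp p q - geodesic_hyperplane p q ?P"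
    unfolding image_half_space[OF assms] hyp_def geodesic_hyperplane_def
    using infinity_height_eq_0_if_same_proj[OF assms] by blast
qed

end
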